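(* Let $\phi: B_a\to\mathbb{R}^N$ be a homeomorphism from $B_a$ onto $\mathbb{R}^N$ with $\phi(0)=0$ and $\phi=\nabla\Phi$ on $B_a$, where $\Phi:\overline{B}_a\to\mathbb{R}$ is of class $C^1$ on $B_a$, continuous and strictly convex on $\overline{B}_a$, and $\Phi(0)=0$. Let $\gamma:\mathbb{R}^N\times\mathbb{R}^N\to 2^{\mathbb{R}^N\times\mathbb{R}^N}$ be a maximal monotone operator with $(0,0)\in\gamma(0,0)$, and let $f:\mathbb{Z}[1,T]\times(\mathbb{R}^N)^{T+2}\to\mathbb{R}^N$ be continuous. Assume that, for all $n\in\mathbb{Z}[1,T]$, the following hold: $$M_n(\rho):=\sup\left\{|f(n,x^0,\dots,x^{T+1})| : x^0,\dots,x^{T+1}\in\mathbb{R}^N \text{ and } |x^n|\le\rho\right\}<+\infty\quad\text{for all }\rho>0,$$ and $$\limsup_{|x^n|\to\infty}\frac{\langle f(n,x^0,\dots,x^{T+1})|x^n\rangle}{|x^n|^2}<0,\quad\text{uniformly with respect to } x^0,\dots,x^{n-1},x^{n+1},\dots,x^{T+1}\in\mathbb{R}^N.$$ Then the problem $$\begin{cases}-\Delta[\phi(\Delta u(n-1))]=f(n,u(0),u(1),\dots,u(T+1)) & (n\in\mathbb{Z}[1,T]),\\ (\phi(\Delta u(0)),-\phi(\Delta u(T)))\in\gamma(u(0),u(T+1))\end{cases}$$ has at least one solution.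
   Context: $N\ge 1$ and $T\ge 2$ are fixed integers and $a>0$ is fixed. $\langle\cdot|\cdot\rangle$ and $|\cdot|$ are the Euclidean inner product and norm on $\mathbb{R}^N$, and $\mathbb{R}^N\times\mathbb{R}^N$ carries its usual inner product (monotonicity is understood with respect to it). $B_a=\{x\in\mathbb{R}^N:|x|<a\}$. $\mathbb{Z}[p,q]=\{p,p+1,\dots,q\}$. The uniform limsup condition means: for each $n\in\mathbb{Z}[1,T]$ there are $\sigma(n)>0$ and $\rho(n)>0$ such that $\langle f(n,x^0,\dots,x^{T+1})|x^n\rangle<-\sigma(n)|x^n|^2$ whenever $|x^n|>\rho(n)$, for all values of the other variables. For $u:\mathbb{Z}[0,T+1]\to\mathbb{R}^N$: $\Delta u(n-1)=u(n)-u(n-1)$, $\Delta[\phi(\Delta u(n-1))]=\phi(\Delta u(n))-\phi(\Delta u(n-1))$, and $\|\Delta u\|_\infty=\max_{n\in\mathbb{Z}[1,T+1]}|\Delta u(n-1)|$. $D(\gamma)=\{z:\gamma(z)\ne\emptyset\}$. A solution of the problem is a function $u:\mathbb{Z}[0,T+1]\to\mathbb{R}^N$ with $\|\Delta u\|_\infty<a$ and $(u(0),u(T+1))\in D(\gamma)$ that satisfies both the equations and the boundary condition. *)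

theory Defs
  imports "HOL-Analysis.Analysis"
begin

definition fdiff :: "(nat \<Rightarrow> 'a::ab_group_add) \<Rightarrow> nat \<Rightarrow> 'a" where
  "fdiff v n = v (Suc n) - v n"

(* The functions Z[0,T+1] -> R^N, which also encode the tuples (x^0,...,x^(T+1)) in
   (R^N)^(T+2).  They are represented by their extensional extensions to nat; the topology
   induced on this set by the product topology of nat => R^N is the one of (R^N)^(T+2). *)
definition grid_funs :: "nat \<Rightarrow> (nat \<Rightarrow> 'a) set" where
  "grid_funs T = {0..T+1} \<rightarrow>\<^sub>E UNIV"

definition fdiff_sup_norm :: "nat \<Rightarrow> (nat \<Rightarrow> 'a::real_normed_vector) \<Rightarrow> real" where
  "fdiff_sup_norm T u = Max ((\<lambda>n. norm (fdiff u (n - 1))) ` {1..T+1})"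

definition strictly_convex_on :: "'a::real_vector set \<Rightarrow> ('a \<Rightarrow> real) \<Rightarrow> bool" where
  "strictly_convex_on S f \<longleftrightarrow> convex S \<and>
     (\<forall>x\<in>S. \<forall>y\<in>S. \<forall>t. x \<noteq> y \<and> 0 < t \<and> t < 1 \<longrightarrow>
        f ((1 - t) *\<^sub>R x + t *\<^sub>R y) < (1 - t) * f x + t * f y)"

(* Meant for open S. *)
definition C1_on :: "'a::real_inner set \<Rightarrow> ('a \<Rightarrow> real) \<Rightarrow> bool" where
  "C1_on S f \<longleftrightarrow> (\<exists>g. (\<forall>x\<in>S. GDERIV f x :> g x) \<and> continuous_on S g)"

definition monotone_operator :: "('a::real_inner \<Rightarrow> 'a set) \<Rightarrow> bool" where
  "monotone_operator \<gamma> \<longleftrightarrow>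
     (\<forall>z w. \<forall>\<zeta>\<in>\<gamma> z. \<forall>\<eta>\<in>\<gamma> w. 0 \<le> (\<zeta> - \<eta>) \<bullet> (z - w))"

definition maximal_monotone :: "('a::real_inner \<Rightarrow> 'a set) \<Rightarrow> bool" where
  "maximal_monotone \<gamma> \<longleftrightarrow> monotone_operator \<gamma> \<and>
     (\<forall>\<delta>. monotone_operator \<delta> \<and> (\<forall>z. \<gamma> z \<subseteq> \<delta> z) \<longrightarrow> \<delta> = \<gamma>)"

definition operator_domain :: "('a \<Rightarrow> 'b set) \<Rightarrow> 'a set" where
  "operator_domain \<gamma> = {z. \<gamma> z \<noteq> {}}"

definition M_bound ::
  "nat \<Rightarrow> (nat \<Rightarrow> (nat \<Rightarrow> 'a) \<Rightarrow> 'a::real_normed_vector) \<Rightarrow> nat \<Rightarrow> real \<Rightarrow> ereal" where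
  "M_bound T f n \<rho> = Sup {ereal (norm (f n x)) | x. x \<in> grid_funs T \<and> norm (x n) \<le> \<rho>}"

(* limsup of <f(n,x) | x^n> / |x^n|^2 as |x^n| tends to infinity is negative, uniformly
   in the other components of x *)
definition uniform_limsup_neg ::
  "nat \<Rightarrow> (nat \<Rightarrow> (nat \<Rightarrow> 'a) \<Rightarrow> 'a::real_inner) \<Rightarrow> nat \<Rightarrow> bool" where
  "uniform_limsup_neg T f n \<longleftrightarrow> (\<exists>\<sigma>>0. \<exists>\<rho>>0. \<forall>x\<in>grid_funs T.
     norm (x n) > \<rho> \<longrightarrow> f n x \<bullet> x n < - \<sigma> * (norm (x n))\<^sup>2)"

definition is_solution ::
  "real \<Rightarrow> nat \<Rightarrow> ('a::real_inner \<Rightarrow> 'a) \<Rightarrow> ('a \<times> 'a \<Rightarrow> ('a \<times> 'a) set) \<Rightarrow>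
   (nat \<Rightarrow> (nat \<Rightarrow> 'a) \<Rightarrow> 'a) \<Rightarrow> (nat \<Rightarrow> 'a) \<Rightarrow> bool" where
  "is_solution a T \<phi> \<gamma> f u \<longleftrightarrow>
     u \<in> grid_funs T \<and>
     fdiff_sup_norm T u < a \<and>
     (u 0, u (T+1)) \<in> operator_domain \<gamma> \<and>
     (\<forall>n\<in>{1..T}. - fdiff (\<lambda>m. \<phi> (fdiff u m)) (n - 1) = f n u) \<and>
     (\<phi> (fdiff u 0), - \<phi> (fdiff u T)) \<in> \<gamma> (u 0, u (T+1))"

end

theory Submission
  imports Defs
begin

text \<open>
The unknown is \<open>u = (u(0), \<dots>, u(T+1))\<close>, the pair of end points is \<open>z = (u(0), u(T+1))\<close>, and
\<open>w(n) = \<phi>(\<Delta>u(n))\<close>. The boundary condition says that \<open>\<beta> = (w(0), -w(T))\<close> belongs to \<open>\<gamma>(z)\<close>. By Minty's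
theorem (\<open>minty\<close>) the resolvent \<open>J = (I + \<gamma>)\<^sup>-\<^sup>1\<close> is everywhere defined and continuous, and the boundary
condition becomes the equation \<open>z - J (z + \<beta>) = 0\<close>. So the problem asks for a zero of a continuous map \<open>F\<close>
of the finite-dimensional space of all \<open>u\<close>, except that \<open>\<phi>\<close> only lives on a ball; it is first replaced by
a continuous map \<open>\<phi>'\<close> on the whole space which agrees with \<open>\<phi>\<close> on a smaller ball of radius \<open>b < a\<close>, with
\<open>\<langle>\<phi>'(x) | x\<rangle> \<ge> 0\<close> everywhere and \<open>\<langle>\<phi>'(x) | x\<rangle> > K\<close> for \<open>|x| \<ge> b\<close>, where \<open>K\<close> is any constant prescribed beforehand
(\<open>singular_gradient_coercive_extension\<close>).

By a consequence of the Poincare-Miranda theorem (\<open>zero_or_inward_ray_vec\<close>), on each ball of radius \<open>r\<close>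
there is a \<open>u\<close> with \<open>F(u) = -\<mu>u\<close> and \<open>\<mu> \<ge> 0\<close>, where \<open>\<mu> > 0\<close> is possible only for \<open>|u| = r\<close>. The second case is excluded
by an a priori estimate, where now \<open>w(n) = \<phi>'(\<Delta>u(n))\<close>. Taking inner products with \<open>u(n)\<close>, summing by parts, and using
\<open>\<langle>f(n,u) | u(n)\<rangle> \<le> \<kappa>(n) - \<sigma>(n)|u(n)|\<^sup>2\<close> (a consequence of the two hypotheses on \<open>f\<close>) and \<open>\<langle>\<beta> | z\<rangle> \<ge> 0\<close> (monotonicity of
\<open>\<gamma>\<close> against \<open>0 \<in> \<gamma>(0)\<close>) gives
\<open>\<Sum>\<^sub>n \<langle>w(n) | \<Delta>u(n)\<rangle> + \<Sum>\<^sub>n \<sigma>(n)|u(n)|\<^sup>2 \<le> K\<close> with \<open>K = \<Sum>\<^sub>n \<kappa>(n)\<close>.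
All terms are nonnegative. Hence \<open>|\<Delta>u(n)| < b\<close> for all \<open>n\<close>, which makes \<open>\<phi>'\<close> and \<open>\<phi>\<close> indistinguishable along \<open>u\<close>,
and the interior values, and with them the end points, are bounded independently of \<open>r\<close>. For \<open>r\<close> large,
\<open>\<mu> = 0\<close> and \<open>u\<close> is a solution.
\<close>

section \<open>Zeros of continuous maps in finitely many coordinates\<close>

lemma compact_PiE_interval:
  fixes I :: "'i::countable set"
  shows "compact (PiE I (\<lambda>_. {-R..R::real}))"
proof -
  have "compactin (product_topology (\<lambda>_::'i. euclidean :: real topology) UNIV)
         (PiE UNIV (\<lambda>i. if i \<in> I then {-R..R} else {undefined}))"
    by (subst compactin_PiE) (auto simp: compactin_euclidean_iff)
  moreover have "PiE UNIV (\<lambda>i. if i \<in> I then {-R..R} else {undefined}) = PiE I (\<lambda>_. {-R..R})"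
    by (auto simp: PiE_def Pi_def extensional_def split: if_splits)
  ultimately show ?thesis
    by (simp add: euclidean_product_topology flip: compactin_euclidean_iff)
qed

lemma tendsto_apply_fun:
  fixes f :: "'b \<Rightarrow> 'i \<Rightarrow> 'a::topological_space"
  assumes "(f \<longlongrightarrow> l) F"
  shows "((\<lambda>x. f x i) \<longlongrightarrow> l i) F"
  by (rule continuous_on_tendsto_compose[OF continuous_on_product_coordinates assms]) auto

lemma tendsto_fun_coordinatewise:
  fixes f :: "'b \<Rightarrow> 'i \<Rightarrow> 'a::topological_space"
  assumes "\<And>i. ((\<lambda>x. f x i) \<longlongrightarrow> l i) F"
  shows "(f \<longlongrightarrow> l) F"
  using assms limitin_componentwise[of "\<lambda>_. euclidean" UNIV f l F]
  by (simp add: euclidean_product_topology)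

text \<open>
The Poincare-Miranda theorem for an arbitrary finite index set. The dimension is the cardinality of \<open>I\<close>
rather than a type, as is needed when the number of unknowns depends on \<open>T\<close>. Colouring the grid points of mesh
\<open>2R/p\<close> by the signs of the components of \<open>F\<close>, Kuhn's combinatorial lemma gives a small cube in which each
component takes a nonpositive and a nonnegative value; a limit of these cubes is a zero.
\<close>

lemma poincare_miranda:
  fixes I :: "'i::countable set" and F :: "('i \<Rightarrow> real) \<Rightarrow> 'i \<Rightarrow> real"
  assumes "finite I" "R > 0"
    and cont: "\<And>i. i \<in> I \<Longrightarrow> continuous_on (PiE I (\<lambda>_. {-R..R})) (\<lambda>x. F x i)"
    and upper: "\<And>x i. x \<in> PiE I (\<lambda>_. {-R..R}) \<Longrightarrow> i \<in> I \<Longrightarrow> x i = R \<Longrightarrow> F x i \<ge> 0"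
    and lower: "\<And>x i. x \<in> PiE I (\<lambda>_. {-R..R}) \<Longrightarrow> i \<in> I \<Longrightarrow> x i = -R \<Longrightarrow> F x i \<le> 0"
  obtains x where "x \<in> PiE I (\<lambda>_. {-R..R})" "\<And>i. i \<in> I \<Longrightarrow> F x i = 0"
proof -
  define Q where "Q = PiE I (\<lambda>_. {-R..R})"
  define n where "n = card I"
  obtain h where h: "bij_betw h {..<n} I"
    using \<open>finite I\<close> n_def by (metis bij_betw_from_nat_into_finite)
  define k where "k = the_inv_into {..<n} h"
  have kI: "k i < n" "h (k i) = i" if "i \<in> I" for i
  proof -
    have "k i \<in> {..<n}"
      unfolding k_def using h that by (metis bij_betwE bij_betw_the_inv_into)
    then show "k i < n" by simp
    show "h (k i) = i"
      unfolding k_def using h that by (simp add: f_the_inv_into_f_bij_betw)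
  qed
  have hI: "h j \<in> I" "k (h j) = j" if "j < n" for j
    using h that by (auto simp: bij_betw_def k_def the_inv_into_f_f)
  \<comment> \<open>\<open>X p q\<close> is the grid point of mesh \<open>2R/p\<close> with integer coordinates \<open>q\<close>.\<close>
  define X :: "nat \<Rightarrow> (nat \<Rightarrow> nat) \<Rightarrow> 'i \<Rightarrow> real"
    where "X p q = (\<lambda>i\<in>I. -R + 2 * R * real (q (k i)) / real p)" for p q
  have XQ: "X p q \<in> Q" if "0 < p" "\<forall>j<n. q j \<le> p" for p q
    unfolding Q_def X_def
  proof (intro restrict_PiE_iff[THEN iffD2] ballI)
    fix i assume "i \<in> I"
    then have "q (k i) \<le> p" using kI that by blast
    then have "real (q (k i)) / real p \<le> 1" "0 \<le> real (q (k i)) / real p"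
      using that by (auto simp: divide_le_eq)
    then have "R * (real (q (k i)) / real p) \<le> R * 1" "0 \<le> R * (real (q (k i)) / real p)"
      using \<open>R > 0\<close> by (intro mult_left_mono mult_nonneg_nonneg; simp)+
    then show "- R + 2 * R * real (q (k i)) / real p \<in> {-R..R}"
      by (simp add: mult.assoc mult.left_commute[of _ 2] flip: times_divide_eq_right)
  qed
  have step: "\<exists>q. (\<forall>j<n. q j < p) \<and> (\<forall>i\<in>I. \<exists>r s.
      (\<forall>j<n. q j \<le> r j \<and> r j \<le> q j + 1) \<and> (\<forall>j<n. q j \<le> s j \<and> s j \<le> q j + 1) \<and>
      F (X p r) i \<le> 0 \<and> F (X p s) i \<ge> 0)" if "0 < p" for p
  proof -
    \<comment> \<open>The faces are labelled as Kuhn's lemma prescribes; there the sign follows from \<open>upper\<close> and \<open>lower\<close>.\<close>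
    define label :: "(nat \<Rightarrow> nat) \<Rightarrow> nat \<Rightarrow> nat" where
      "label q j = (if q j = p \<or> (q j \<noteq> 0 \<and> F (X p q) (h j) > 0) then 1 else 0)" for q j
    have lab0: "F (X p q) (h j) \<le> 0" if "label q j = 0" "\<forall>j<n. q j \<le> p" "j < n" for q j
    proof (cases "q j = 0")
      case True
      then have "X p q (h j) = -R" using hI that by (simp add: X_def)
      then show ?thesis using lower[OF XQ[unfolded Q_def] hI(1)] \<open>0 < p\<close> that by simp
    next
      case False
      then show ?thesis using that by (auto simp: label_def split: if_splits)
    qed
    have lab1: "F (X p q) (h j) \<ge> 0" if "label q j \<noteq> 0" "\<forall>j<n. q j \<le> p" "j < n" for q j
    proof (cases "q j = p")
      case True
      then have "X p q (h j) = R" using hI that \<open>0 < p\<close> by (simp add: X_def)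
      then show ?thesis using upper[OF XQ[unfolded Q_def] hI(1)] \<open>0 < p\<close> that by simp
    next
      case False
      then show ?thesis using that by (auto simp: label_def split: if_splits)
    qed
    obtain q where q: "\<forall>i<n. q i < p"
      "\<forall>i<n. \<exists>r s. (\<forall>j<n. q j \<le> r j \<and> r j \<le> q j + 1) \<and>
          (\<forall>j<n. q j \<le> s j \<and> s j \<le> q j + 1) \<and> label r i \<noteq> label s i"
      by (rule kuhn_lemma[of p n label, OF \<open>0 < p\<close>]) (use \<open>0 < p\<close> in \<open>auto simp: label_def\<close>)
    have "\<exists>r s. (\<forall>j<n. q j \<le> r j \<and> r j \<le> q j + 1) \<and> (\<forall>j<n. q j \<le> s j \<and> s j \<le> q j + 1) \<and>
      F (X p r) i \<le> 0 \<and> F (X p s) i \<ge> 0" if i: "i \<in> I" for i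
    proof -
      obtain r s where rs: "\<forall>j<n. q j \<le> r j \<and> r j \<le> q j + 1"
          "\<forall>j<n. q j \<le> s j \<and> s j \<le> q j + 1" "label r (k i) \<noteq> label s (k i)"
        using q(2) kI(1)[OF i] by blast
      have le: "\<forall>j<n. r j \<le> p" "\<forall>j<n. s j \<le> p"
        using rs(1,2) q(1) by (metis Suc_eq_plus1 Suc_leI le_trans)+
      show ?thesis
      proof (cases "label r (k i) = 0")
        case True
        then have "label s (k i) \<noteq> 0" using rs by simp
        then show ?thesis using True rs le lab0[of r "k i"] lab1[of s "k i"] kI[OF i] by metis
      next
        case False
        then have "label s (k i) = 0" using rs(3) by (auto simp: label_def split: if_splits)
        then show ?thesis using False rs le lab0[of s "k i"] lab1[of r "k i"] kI[OF i] by metis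
      qed
    qed
    then show ?thesis using q(1) by blast
  qed
  define P where "P p q r s i \<longleftrightarrow> (\<forall>j<n. q j \<le> r j \<and> r j \<le> q j + 1) \<and>
     (\<forall>j<n. q j \<le> s j \<and> s j \<le> q j + 1) \<and> F (X p r) i \<le> 0 \<and> F (X p s) i \<ge> 0"
    for p and q r s :: "nat \<Rightarrow> nat" and i
  have "\<exists>q r s. (\<forall>j<n. q j < Suc p) \<and> (\<forall>i\<in>I. P (Suc p) q (r i) (s i) i)" for p
    using step[of "Suc p"] unfolding P_def by (simp only: zero_less_Suc) metis
  then obtain q r s where qrs: "\<And>p. \<forall>j<n. q p j < Suc p"
      "\<And>p. \<forall>i\<in>I. P (Suc p) (q p) (r p i) (s p i) i"
    by metis
  have qQ: "X (Suc p) (q p) \<in> Q" for p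
    using qrs(1)[of p] by (intro XQ) (auto simp: less_imp_le)
  have "seq_compact Q"
    unfolding Q_def using compact_PiE_interval compact_eq_seq_compact_metric by blast
  then obtain x g where xg: "x \<in> Q" "strict_mono g" "(\<lambda>p. X (Suc (g p)) (q (g p))) \<longlonglongrightarrow> x"
    using seq_compactE[of Q "\<lambda>p. X (Suc p) (q p)"] qQ by (auto simp: o_def)
  \<comment> \<open>All vertices of the small cubes converge to the same limit as the cubes' corners.\<close>
  have near: "(\<lambda>p. X (Suc (g p)) (t p)) \<longlonglongrightarrow> x"
    if t: "\<And>p. \<forall>j<n. q (g p) j \<le> t p j \<and> t p j \<le> q (g p) j + 1" for t
  proof (rule tendsto_fun_coordinatewise)
    fix i
    have A: "(\<lambda>p. X (Suc (g p)) (q (g p)) i) \<longlonglongrightarrow> x i"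
      by (rule tendsto_apply_fun[OF xg(3)])
    show "(\<lambda>p. X (Suc (g p)) (t p) i) \<longlonglongrightarrow> x i"
    proof (cases "i \<in> I")
      case True
      have "(\<lambda>p. 2 * R * (1 / real (Suc p))) \<longlonglongrightarrow> 2 * R * 0"
        by (intro tendsto_intros LIMSEQ_Suc[OF lim_1_over_n])
      from LIMSEQ_subseq_LIMSEQ[OF this xg(2)]
      have B: "(\<lambda>p. 2 * R * (1 / real (Suc (g p)))) \<longlonglongrightarrow> 0" by (simp add: o_def)
      have "(\<lambda>p. X (Suc (g p)) (t p) i - X (Suc (g p)) (q (g p)) i) \<longlonglongrightarrow> 0"
      proof (rule tendsto_rabs_zero_cancel, rule tendsto_sandwich[OF _ _ tendsto_const B])
        show "\<forall>\<^sub>F p in sequentially. \<bar>X (Suc (g p)) (t p) i - X (Suc (g p)) (q (g p)) i\<bar>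
            \<le> 2 * R * (1 / real (Suc (g p)))"
        proof (intro always_eventually allI)
          fix p
          have "q (g p) (k i) \<le> t p (k i)" "t p (k i) \<le> q (g p) (k i) + 1"
            using t[of p] kI(1)[OF True] by blast+
          then have d: "0 \<le> real (t p (k i)) - real (q (g p) (k i))"
            "real (t p (k i)) - real (q (g p) (k i)) \<le> 1"
            by linarith+
          have "X (Suc (g p)) (t p) i - X (Suc (g p)) (q (g p)) i
             = 2 * R * ((real (t p (k i)) - real (q (g p) (k i))) / real (Suc (g p)))"
            using True by (simp add: X_def diff_divide_distrib algebra_simps)
          moreover have "0 \<le> 2 * R * ((real (t p (k i)) - real (q (g p) (k i))) / real (Suc (g p)))"
            using d \<open>R > 0\<close> by simp
          moreover have "2 * R * ((real (t p (k i)) - real (q (g p) (k i))) / real (Suc (g p)))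
              \<le> 2 * R * (1 / real (Suc (g p)))"
            using d \<open>R > 0\<close> by (intro mult_left_mono divide_right_mono) auto
          ultimately show "\<bar>X (Suc (g p)) (t p) i - X (Suc (g p)) (q (g p)) i\<bar>
            \<le> 2 * R * (1 / real (Suc (g p)))" by linarith
        qed
      qed auto
      from tendsto_add[OF this A] show ?thesis by simp
    next
      case False
      then show ?thesis using A by (simp add: X_def)
    qed
  qed
  have FX: "(\<lambda>p. F (X (Suc (g p)) (t p)) i) \<longlonglongrightarrow> F x i"
    if t: "\<And>p. \<forall>j<n. q (g p) j \<le> t p j \<and> t p j \<le> q (g p) j + 1" and "i \<in> I" for t i
  proof (rule continuous_on_tendsto_compose[OF cont near])
    show "\<forall>\<^sub>F p in sequentially. X (Suc (g p)) (t p) \<in> PiE I (\<lambda>_. {-R..R})"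
    proof (intro always_eventually allI)
      fix p
      have "\<forall>j<n. t p j \<le> Suc (g p)"
        using t[of p] qrs(1)[of "g p"] by (metis Suc_eq_plus1 Suc_leI le_trans)
      then show "X (Suc (g p)) (t p) \<in> PiE I (\<lambda>_. {-R..R})"
        using XQ[of "Suc (g p)" "t p"] by (simp add: Q_def)
    qed
  qed (use that xg in \<open>auto simp: Q_def\<close>)
  have "F x i = 0" if "i \<in> I" for i
  proof (rule antisym)
    have Pi: "P (Suc (g p)) (q (g p)) (r (g p) i) (s (g p) i) i" for p
      using qrs(2) that by blast
    show "F x i \<le> 0"
      by (rule LIMSEQ_le_const2[OF FX[of "\<lambda>p. r (g p) i"]]) (use Pi that in \<open>auto simp: P_def\<close>)
    show "0 \<le> F x i"
      by (rule LIMSEQ_le_const[OF FX[of "\<lambda>p. s (g p) i"]]) (use Pi that in \<open>auto simp: P_def\<close>)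
  qed
  then show thesis using that xg(1) Q_def by blast
qed

text \<open>
If \<open>\<pi>\<close> is the radial projection onto the Euclidean ball of radius \<open>r\<close>, then \<open>x \<mapsto> F (\<pi> x) + (x - \<pi> x)\<close> points
outwards on the faces of a large cube, and so has a zero \<open>x\<close>; the point sought is \<open>\<pi> x\<close>.
\<close>

lemma zero_or_inward_ray:
  fixes I :: "'i::countable set" and F :: "('i \<Rightarrow> real) \<Rightarrow> 'i \<Rightarrow> real"
  assumes "finite I" "r > 0"
    and cont: "\<And>i. i \<in> I \<Longrightarrow> continuous_on (PiE I (\<lambda>_. UNIV)) (\<lambda>x. F x i)"
  obtains x \<mu> where "x \<in> PiE I (\<lambda>_. UNIV)" "\<mu> \<ge> 0" "\<And>i. i \<in> I \<Longrightarrow> F x i = - \<mu> * x i"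
    "(\<Sum>i\<in>I. (x i)\<^sup>2) \<le> r\<^sup>2" "\<mu> > 0 \<Longrightarrow> (\<Sum>i\<in>I. (x i)\<^sup>2) = r\<^sup>2"
proof -
  define c where "c x = max 1 (L2_set x I / r)" for x :: "'i \<Rightarrow> real"
  define \<pi> where "\<pi> x = (\<lambda>i\<in>I. x i / c x)" for x
  have c1: "c x \<ge> 1" for x by (simp add: c_def)
  have c0: "c x \<noteq> 0" for x using c1[of x] by simp
  have Lc: "L2_set x I \<le> c x * r" for x
    using \<open>r > 0\<close> by (simp add: c_def field_simps max_def)
  have absL: "\<bar>x i\<bar> \<le> L2_set x I" if "i \<in> I" for x i
    using member_le_L2_set[OF \<open>finite I\<close> that, of "\<lambda>i. \<bar>x i\<bar>"] by (simp add: L2_set_def)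
  have \<pi>box: "\<pi> x \<in> PiE I (\<lambda>_. {-r..r})" for x
  proof -
    have "- r \<le> x i / c x \<and> x i / c x \<le> r" if "i \<in> I" for i
    proof -
      have "\<bar>x i\<bar> \<le> r * c x" using absL[OF that, of x] Lc[of x] by (simp add: mult.commute)
      then show ?thesis using c1[of x] by (simp add: le_divide_eq divide_le_eq abs_le_iff)
    qed
    then show ?thesis unfolding \<pi>_def by auto
  qed
  have \<pi>cont: "continuous_on S \<pi>" for S
  proof (rule continuous_on_coordinatewise_then_product)
    fix i
    have coord: "continuous_on S (\<lambda>x::'i \<Rightarrow> real. x i)" for i
      by (rule continuous_on_subset[OF continuous_on_product_coordinates]) simp
    have "continuous_on S c"
      unfolding c_def L2_set_def using \<open>r > 0\<close> by (intro continuous_intros coord) auto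
    then show "continuous_on S (\<lambda>x. \<pi> x i)"
      unfolding \<pi>_def using c0 coord
      by (cases "i \<in> I") (auto intro!: continuous_intros)
  qed
  have "\<exists>B. \<forall>x\<in>PiE I (\<lambda>_. {-r..r}). \<bar>F x i\<bar> \<le> B" if "i \<in> I" for i
  proof -
    have "continuous_on (PiE I (\<lambda>_. {-r..r})) (\<lambda>x. F x i)"
      by (rule continuous_on_subset[OF cont[OF that]]) auto
    then have "bounded ((\<lambda>x. F x i) ` PiE I (\<lambda>_. {-r..r}))"
      by (intro compact_imp_bounded compact_continuous_image compact_PiE_interval)
    then show ?thesis by (auto simp: bounded_iff)
  qed
  then obtain B where B: "\<And>i x. i \<in> I \<Longrightarrow> x \<in> PiE I (\<lambda>_. {-r..r}) \<Longrightarrow> \<bar>F x i\<bar> \<le> B i" by metis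
  define M where "M = (\<Sum>i\<in>I. \<bar>B i\<bar>)"
  have M: "\<bar>F (\<pi> x) i\<bar> \<le> M" if "i \<in> I" for x i
  proof -
    have "\<bar>F (\<pi> x) i\<bar> \<le> \<bar>B i\<bar>" using B[OF that \<pi>box[of x]] by simp
    also have "\<dots> \<le> M" unfolding M_def using that \<open>finite I\<close> by (intro member_le_sum) auto
    finally show ?thesis .
  qed
  have "M \<ge> 0" unfolding M_def by (simp add: sum_nonneg)
  define G where "G x i = F (\<pi> x) i + (x i - \<pi> x i)" for x i
  \<comment> \<open>On a face of the cube of half side \<open>r + M\<close> the term \<open>x i - \<pi> x i\<close> has absolute value at least \<open>M\<close>.\<close>
  have far: "\<bar>\<pi> x i\<bar> \<le> r" if "i \<in> I" for x i
    using PiE_mem[OF \<pi>box[of x] that] by (simp add: abs_le_iff)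
  obtain x where x: "x \<in> PiE I (\<lambda>_. {-(r + M)..r + M})" "\<And>i. i \<in> I \<Longrightarrow> G x i = 0"
  proof (rule poincare_miranda[of I "r + M" G])
    show "continuous_on (PiE I (\<lambda>_. {-(r + M)..r + M})) (\<lambda>x. G x i)" if "i \<in> I" for i
      unfolding G_def
      by (intro continuous_intros continuous_on_compose2[OF cont[OF that] \<pi>cont]
            continuous_on_product_then_coordinatewise[OF \<pi>cont]
            continuous_on_subset[OF continuous_on_product_coordinates])
        (auto simp: \<pi>_def)
    show "0 \<le> G x i" if "i \<in> I" "x i = r + M" for x i
      using far[of i x] M[of i x] that unfolding G_def by linarith
    show "G x i \<le> 0" if "i \<in> I" "x i = - (r + M)" for x i
      using far[of i x] M[of i x] that unfolding G_def by linarith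
  qed (use assms \<open>M \<ge> 0\<close> in auto)
  have sq: "(\<Sum>i\<in>I. (\<pi> x i)\<^sup>2) = (L2_set x I / c x)\<^sup>2"
    by (simp add: \<pi>_def power_divide L2_set_def sum_nonneg flip: sum_divide_distrib)
  show thesis
  proof (rule that[of "\<pi> x" "c x - 1"])
    show "\<pi> x \<in> PiE I (\<lambda>_. UNIV)" by (simp add: \<pi>_def)
    show "F (\<pi> x) i = - (c x - 1) * \<pi> x i" if "i \<in> I" for i
    proof -
      have "x i = c x * \<pi> x i" using that c1[of x] by (simp add: \<pi>_def)
      then show ?thesis using x(2)[OF that] unfolding G_def by (simp add: algebra_simps)
    qed
    have "L2_set x I / c x \<le> r"
      using Lc[of x] c1[of x] by (simp add: divide_le_eq mult.commute)
    then show "(\<Sum>i\<in>I. (\<pi> x i)\<^sup>2) \<le> r\<^sup>2"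
      unfolding sq using c1[of x] by (intro power_mono) auto
    show "(\<Sum>i\<in>I. (\<pi> x i)\<^sup>2) = r\<^sup>2" if "0 < c x - 1"
    proof -
      have "c x = L2_set x I / r" using that by (auto simp: c_def max_def split: if_splits)
      then show ?thesis unfolding sq using that \<open>r > 0\<close> by auto
    qed
  qed (use c1[of x] in simp)
qed

lemma zero_or_inward_ray_vec:
  fixes A :: "'j::countable set" and F :: "('j \<Rightarrow> real ^ 'n) \<Rightarrow> 'j \<Rightarrow> real ^ 'n"
  assumes "finite A" "r > 0"
    and cont: "\<And>j. j \<in> A \<Longrightarrow> continuous_on (PiE A (\<lambda>_. UNIV)) (\<lambda>u. F u j)"
  obtains u \<mu> where "u \<in> PiE A (\<lambda>_. UNIV)" "\<mu> \<ge> 0" "\<And>j. j \<in> A \<Longrightarrow> F u j = - \<mu> *\<^sub>R u j"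
    "(\<Sum>j\<in>A. (norm (u j))\<^sup>2) \<le> r\<^sup>2" "\<mu> > 0 \<Longrightarrow> (\<Sum>j\<in>A. (norm (u j))\<^sup>2) = r\<^sup>2"
proof -
  define U :: "('j \<times> 'n \<Rightarrow> real) \<Rightarrow> 'j \<Rightarrow> real ^ 'n"
    where "U x = (\<lambda>j\<in>A. \<chi> i. x (j, i))" for x
  have Ucont: "continuous_on S U" for S
  proof (rule continuous_on_coordinatewise_then_product)
    fix j
    show "continuous_on S (\<lambda>x. U x j)"
      unfolding U_def
      by (cases "j \<in> A")
        (auto intro!: continuous_intros continuous_on_subset[OF continuous_on_product_coordinates])
  qed
  obtain x \<mu> where x: "\<mu> \<ge> 0" "\<And>i. i \<in> A \<times> UNIV \<Longrightarrow> F (U x) (fst i) $ snd i = - \<mu> * x i"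
    "(\<Sum>i\<in>A \<times> UNIV. (x i)\<^sup>2) \<le> r\<^sup>2" "\<mu> > 0 \<Longrightarrow> (\<Sum>i\<in>A \<times> UNIV. (x i)\<^sup>2) = r\<^sup>2"
  proof (rule zero_or_inward_ray[of "A \<times> (UNIV :: 'n set)" r "\<lambda>x i. F (U x) (fst i) $ snd i"])
    show "continuous_on (PiE (A \<times> (UNIV :: 'n set)) (\<lambda>_. UNIV)) (\<lambda>x. F (U x) (fst i) $ snd i)"
      if "i \<in> A \<times> UNIV" for i
      by (intro continuous_on_component continuous_on_compose2[OF cont Ucont])
        (use that in \<open>auto simp: U_def\<close>)
  qed (use assms in auto)
  have sq: "(\<Sum>j\<in>A. (norm (U x j))\<^sup>2) = (\<Sum>i\<in>A \<times> UNIV. (x i)\<^sup>2)"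
    unfolding power2_norm_eq_inner inner_vec_def sum.cartesian_product'
    by (intro sum.cong refl) (auto simp: U_def power2_eq_square)
  show thesis
  proof (rule that[of "U x" \<mu>])
    show "F (U x) j = - \<mu> *\<^sub>R U x j" if "j \<in> A" for j
      using x(2)[of "(j, _)"] that by (simp add: vec_eq_iff U_def)
  qed (use x sq in \<open>auto simp: U_def\<close>)
qed

section \<open>Minty's theorem and the resolvent\<close>

text \<open>A point monotonically related to the graph of a maximal monotone operator lies on the graph.\<close>

lemma maximal_monotoneD:
  assumes "maximal_monotone \<gamma>" "\<And>z \<zeta>. \<zeta> \<in> \<gamma> z \<Longrightarrow> 0 \<le> (\<zeta> - \<xi>) \<bullet> (z - x)"
  shows "\<xi> \<in> \<gamma> x"
proof -
  define \<delta> where "\<delta> = (\<lambda>z. if z = x then insert \<xi> (\<gamma> x) else \<gamma> z)"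
  have swap: "(\<xi> - \<zeta>) \<bullet> (x - z) = (\<zeta> - \<xi>) \<bullet> (z - x)" for z \<zeta>
    by (metis inner_minus_left inner_minus_right minus_diff_eq minus_minus)
  have "monotone_operator \<delta>"
    using assms swap unfolding maximal_monotone_def monotone_operator_def \<delta>_def by auto
  moreover have "\<forall>z. \<gamma> z \<subseteq> \<delta> z" by (auto simp: \<delta>_def)
  ultimately have "\<delta> = \<gamma>" using assms(1) unfolding maximal_monotone_def by blast
  then show ?thesis by (metis \<delta>_def insertI1)
qed

lemma monotone_family_convex_combination:
  fixes z \<zeta> :: "'i \<Rightarrow> 'a::real_inner"
  assumes "finite S" "\<And>i. i \<in> S \<Longrightarrow> 0 \<le> c i" "sum c S = 1"
    and mono: "\<And>i j. i \<in> S \<Longrightarrow> j \<in> S \<Longrightarrow> 0 \<le> (\<zeta> i - \<zeta> j) \<bullet> (z i - z j)"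
  shows "(\<Sum>i\<in>S. c i *\<^sub>R \<zeta> i) \<bullet> (\<Sum>i\<in>S. c i *\<^sub>R z i) \<le> (\<Sum>i\<in>S. c i * (\<zeta> i \<bullet> z i))"
proof -
  have "0 \<le> (\<Sum>i\<in>S. \<Sum>j\<in>S. c i * c j * ((\<zeta> i - \<zeta> j) \<bullet> (z i - z j)))"
    using assms by (intro sum_nonneg mult_nonneg_nonneg) auto
  also have "\<dots> = (\<Sum>i\<in>S. \<Sum>j\<in>S. c j * (c i * (\<zeta> i \<bullet> z i)) + c i * (c j * (\<zeta> j \<bullet> z j))
      - c i * c j * (\<zeta> i \<bullet> z j) - c j * c i * (\<zeta> j \<bullet> z i))"
    by (intro sum.cong refl) (simp add: inner_diff_left inner_diff_right algebra_simps)
  also have "\<dots> = (\<Sum>i\<in>S. \<Sum>j\<in>S. c j * (c i * (\<zeta> i \<bullet> z i))) + (\<Sum>i\<in>S. \<Sum>j\<in>S. c i * (c j * (\<zeta> j \<bullet> z j)))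
      - (\<Sum>i\<in>S. \<Sum>j\<in>S. c i * c j * (\<zeta> i \<bullet> z j)) - (\<Sum>i\<in>S. \<Sum>j\<in>S. c j * c i * (\<zeta> j \<bullet> z i))"
    by (simp add: sum.distrib sum_subtractf)
  also have "(\<Sum>i\<in>S. \<Sum>j\<in>S. c j * (c i * (\<zeta> i \<bullet> z i))) = (\<Sum>i\<in>S. c i * (\<zeta> i \<bullet> z i))"
    using assms(3) by (simp flip: sum_distrib_right)
  also have "(\<Sum>i\<in>S. \<Sum>j\<in>S. c i * (c j * (\<zeta> j \<bullet> z j))) = (\<Sum>i\<in>S. c i * (\<zeta> i \<bullet> z i))"
    using assms(3) by (simp flip: sum_distrib_left sum_distrib_right)
  also have "(\<Sum>i\<in>S. \<Sum>j\<in>S. c j * c i * (\<zeta> j \<bullet> z i)) = (\<Sum>i\<in>S. \<Sum>j\<in>S. c i * c j * (\<zeta> i \<bullet> z j))"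
    by (rule sum.swap)
  also have "(\<Sum>i\<in>S. \<Sum>j\<in>S. c i * c j * (\<zeta> i \<bullet> z j))
      = (\<Sum>i\<in>S. c i *\<^sub>R \<zeta> i) \<bullet> (\<Sum>i\<in>S. c i *\<^sub>R z i)"
    by (subst sum.swap) (simp add: inner_sum_left inner_sum_right sum_distrib_left mult_ac)
  finally show ?thesis by simp
qed

text \<open>
The finite case of Minty's theorem. For \<open>(z, \<zeta>) \<in> G\<close> the quantity to be made nonpositive is
\<open>|x|\<^sup>2 - x \<bullet> (z - \<zeta>) - \<zeta> \<bullet> z\<close>. The convex function \<open>D(v, s) = |v|\<^sup>2/4 + s\<close> is minimised over the convex hull of the
points \<open>(z - \<zeta>, \<zeta> \<bullet> z)\<close>; monotonicity of \<open>G\<close> makes its minimum nonnegative, and the first-order condition at a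
minimiser \<open>(v, s)\<close> is the claim for \<open>x = v/2\<close>.
\<close>

lemma minty_finite:
  fixes G :: "('a::euclidean_space \<times> 'a) set"
  assumes "finite G" "G \<noteq> {}"
    and mono: "\<And>z \<zeta> w \<eta>. (z, \<zeta>) \<in> G \<Longrightarrow> (w, \<eta>) \<in> G \<Longrightarrow> 0 \<le> (\<zeta> - \<eta>) \<bullet> (z - w)"
  obtains x where "\<And>z \<zeta>. (z, \<zeta>) \<in> G \<Longrightarrow> (\<zeta> + x) \<bullet> (x - z) \<le> 0"
proof -
  define p where "p = (\<lambda>g::'a \<times> 'a. (fst g - snd g, snd g \<bullet> fst g))"
  define C where "C = convex hull (p ` G)"
  define D where "D = (\<lambda>y::'a \<times> real. (norm (fst y))\<^sup>2 / 4 + snd y)"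
  have "compact C" "C \<noteq> {}"
    using assms unfolding C_def by (auto intro: finite_imp_compact_convex_hull)
  moreover have "continuous_on C D" unfolding D_def by (intro continuous_intros) auto
  ultimately obtain m where m: "m \<in> C" "\<And>y. y \<in> C \<Longrightarrow> D m \<le> D y"
    using continuous_attains_inf by metis
  obtain v s where vs: "m = (v, s)" by (cases m)
  have "D m \<ge> 0"
  proof -
    have "m \<in> convex hull (p ` G)" using m C_def by simp
    then obtain c' where c': "\<forall>y\<in>p ` G. 0 \<le> c' y" "sum c' (p ` G) = 1" "(\<Sum>y\<in>p ` G. c' y *\<^sub>R y) = m"
      using convex_hull_finite[of "p ` G"] \<open>finite G\<close> by auto
    \<comment> \<open>Choosing one preimage under \<open>p\<close> of each point turns \<open>m\<close> into a convex combination indexed by pairs of \<open>G\<close>.\<close>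
    obtain H where H: "H \<subseteq> G" "inj_on p H" "p ` H = p ` G"
      by (metis subset_image_inj subset_refl)
    define c where "c g = c' (p g)" for g
    have cH: "sum c H = 1" "(\<Sum>g\<in>H. c g *\<^sub>R p g) = m" "finite H" "\<And>g. g \<in> H \<Longrightarrow> 0 \<le> c g"
      using c' H \<open>finite G\<close> sum.reindex[OF H(2), of c'] sum.reindex[OF H(2), of "\<lambda>y. c' y *\<^sub>R y"]
      by (auto simp: c_def o_def finite_subset)
    define Z where "Z = (\<Sum>g\<in>H. c g *\<^sub>R fst g)"
    define W where "W = (\<Sum>g\<in>H. c g *\<^sub>R snd g)"
    have v: "v = Z - W"
      using arg_cong[OF cH(2), of fst] vs
      by (simp add: fst_sum p_def Z_def W_def scaleR_diff_right sum_subtractf)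
    have s: "s = (\<Sum>g\<in>H. c g * (snd g \<bullet> fst g))"
      using arg_cong[OF cH(2), of snd] vs by (simp add: snd_sum p_def)
    have "W \<bullet> Z \<le> s"
      unfolding W_def Z_def s
      by (rule monotone_family_convex_combination)
        (use cH H mono in \<open>auto simp: subset_iff\<close>)
    moreover have "(norm v)\<^sup>2 = Z \<bullet> Z + W \<bullet> W - 2 * (W \<bullet> Z)"
      "(norm (Z + W))\<^sup>2 = Z \<bullet> Z + W \<bullet> W + 2 * (W \<bullet> Z)"
      unfolding v power2_norm_eq_inner
      by (simp_all add: inner_add_left inner_add_right inner_diff_left inner_diff_right inner_commute)
    moreover have "0 \<le> (norm (Z + W))\<^sup>2" by simp
    ultimately show ?thesis
      unfolding D_def vs fst_conv snd_conv by linarith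
  qed
  show thesis
  proof (rule that[of "v /\<^sub>R 2"])
    fix z \<zeta> assume "(z, \<zeta>) \<in> G"
    then have pC: "p (z, \<zeta>) \<in> C" unfolding C_def by (intro hull_inc imageI)
    \<comment> \<open>\<open>l\<close> is the derivative of \<open>D\<close> at the minimiser in the direction of the point \<open>p (z, \<zeta>)\<close>.\<close>
    define d where "d = z - \<zeta> - v"
    define l where "l = v \<bullet> d / 2 + (\<zeta> \<bullet> z - s)"
    have key: "0 \<le> t * l + t\<^sup>2 * ((norm d)\<^sup>2 / 4)" if t: "0 < t" "t \<le> 1" for t
    proof -
      have "(1 - t) *\<^sub>R m + t *\<^sub>R p (z, \<zeta>) \<in> C"
        using m(1) pC t unfolding C_def by (intro convexD convex_convex_hull) auto
      from m(2)[OF this]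
      have "(norm v)\<^sup>2 / 4 + s \<le> (norm ((1 - t) *\<^sub>R v + t *\<^sub>R (z - \<zeta>)))\<^sup>2 / 4 + ((1 - t) * s + t * (\<zeta> \<bullet> z))"
        by (simp add: D_def vs p_def)
      also have "(1 - t) *\<^sub>R v + t *\<^sub>R (z - \<zeta>) = v + t *\<^sub>R d"
        by (simp add: d_def algebra_simps)
      also have "(norm (v + t *\<^sub>R d))\<^sup>2 = (norm v)\<^sup>2 + 2 * t * (v \<bullet> d) + t\<^sup>2 * (norm d)\<^sup>2"
        unfolding power2_norm_eq_inner
        by (simp add: inner_add_left inner_add_right inner_commute power2_eq_square)
      finally show ?thesis by (simp add: l_def algebra_simps add_divide_distrib)
    qed
    have "l \<ge> 0"
    proof (rule ccontr)
      assume "\<not> l \<ge> 0"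
      define K where "K = (norm d)\<^sup>2 / 4 + 1"
      define t where "t = min 1 (- l / (2 * K))"
      have K: "K > 0" unfolding K_def by (smt (verit) zero_le_power2 divide_nonneg_nonneg)
      have t: "0 < t" "t \<le> 1" using \<open>\<not> l \<ge> 0\<close> K by (auto simp: t_def divide_neg_pos)
      have "t \<le> - l / (2 * K)" by (simp add: t_def)
      then have "t * (2 * K) \<le> - l" using K by (subst (asm) pos_le_divide_eq) auto
      then have "t * K \<le> - l / 2" by simp
      then have "t * (t * K) \<le> t * (- l / 2)" using t by (intro mult_left_mono) auto
      moreover have "t * (t * K) = t\<^sup>2 * ((norm d)\<^sup>2 / 4) + t\<^sup>2"
        by (simp add: K_def power2_eq_square algebra_simps)
      moreover have "t * l < 0" using t \<open>\<not> l \<ge> 0\<close> by (simp add: mult_pos_neg)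
      moreover have "0 \<le> t\<^sup>2" by simp
      moreover have "t * (- l / 2) = - (t * l) / 2" by simp
      ultimately show False using key[OF t] by linarith
    qed
    moreover have "(\<zeta> + v /\<^sub>R 2) \<bullet> (v /\<^sub>R 2 - z) = - l - D m"
      unfolding D_def vs l_def d_def power2_norm_eq_inner
      by (simp add: inner_add_left inner_add_right inner_diff_left inner_diff_right inner_commute field_simps)
    ultimately show "(\<zeta> + v /\<^sub>R 2) \<bullet> (v /\<^sub>R 2 - z) \<le> 0" using \<open>D m \<ge> 0\<close> by simp
  qed
qed

text \<open>
Minty's theorem: \<open>I + \<gamma>\<close> is onto. The condition that \<open>y - x\<close> be monotonically related to one pair of the graph
confines \<open>x\<close> to a closed ball \<open>K\<close>. By the finite case and compactness all these balls have a common point.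
\<close>

lemma minty:
  fixes \<gamma> :: "'a::euclidean_space \<Rightarrow> 'a set"
  assumes "maximal_monotone \<gamma>"
  shows "\<exists>x. y - x \<in> \<gamma> x"
proof -
  define K where "K = (\<lambda>g::'a \<times> 'a. {x. (snd g - y + x) \<bullet> (x - fst g) \<le> 0})"
  define G where "G = {g. snd g \<in> \<gamma> (fst g)}"
  have mono: "0 \<le> (\<zeta> - \<eta>) \<bullet> (z - w)" if "\<zeta> \<in> \<gamma> z" "\<eta> \<in> \<gamma> w" for z w \<zeta> \<eta>
    using assms that unfolding maximal_monotone_def monotone_operator_def by blast
  obtain g0 where "g0 \<in> G"
  proof (cases "G = {}")
    case True
    then have "0 \<in> \<gamma> 0"
      by (intro maximal_monotoneD[OF assms]) (auto simp: G_def)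
    then have "(0, 0) \<in> G" by (simp add: G_def)
    then show thesis using that by blast
  qed (use that in auto)
  have cl: "closed (K g)" for g
    unfolding K_def by (intro closed_Collect_le continuous_intros)
  have bd: "bounded (K g)" for g
  proof -
    define p where "p = snd g - y"
    define q where "q = fst g"
    \<comment> \<open>\<open>K g\<close> is the ball having \<open>q\<close> and \<open>- p\<close> as end points of a diameter.\<close>
    have "dist ((q - p) /\<^sub>R 2) x \<le> norm (p + q) / 2" if "x \<in> K g" for x
    proof -
      have "(norm ((q - p) /\<^sub>R 2 - x))\<^sup>2 = (norm (p + q) / 2)\<^sup>2 + (p + x) \<bullet> (x - q)"
        unfolding power_divide power2_norm_eq_inner
        by (simp add: inner_add_left inner_add_right inner_diff_left inner_diff_right inner_commute field_simps)
      also have "\<dots> \<le> (norm (p + q) / 2)\<^sup>2"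
        using that by (simp add: K_def p_def q_def)
      finally show ?thesis unfolding dist_norm by (rule power2_le_imp_le) simp
    qed
    then have "K g \<subseteq> cball ((q - p) /\<^sub>R 2) (norm (p + q) / 2)" by auto
    then show ?thesis using bounded_cball bounded_subset by blast
  qed
  have "K g0 \<inter> \<Inter> (K ` G) \<noteq> {}"
  proof (rule compact_imp_fip)
    show "compact (K g0)" using cl bd by (simp add: compact_eq_bounded_closed)
    show "closed T" if "T \<in> K ` G" for T using that cl by auto
    fix \<F> assume "finite \<F>" "\<F> \<subseteq> K ` G"
    then obtain G' where G': "finite G'" "G' \<subseteq> G" "\<F> = K ` G'"
      by (meson finite_subset_image)
    define G'' where "G'' = (\<lambda>g. (fst g, snd g - y)) ` insert g0 G'"
    have "\<exists>x. \<forall>z \<zeta>. (z, \<zeta>) \<in> G'' \<longrightarrow> (\<zeta> + x) \<bullet> (x - z) \<le> 0"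
    proof (rule minty_finite[of G''])
      show "finite G''" "G'' \<noteq> {}" using G' by (auto simp: G''_def)
      fix z \<zeta> w \<eta> assume "(z, \<zeta>) \<in> G''" "(w, \<eta>) \<in> G''"
      then have "(z, \<zeta> + y) \<in> G" "(w, \<eta> + y) \<in> G"
        using G' \<open>g0 \<in> G\<close> unfolding G''_def by auto
      then show "0 \<le> (\<zeta> - \<eta>) \<bullet> (z - w)" using mono[of "\<zeta> + y" z "\<eta> + y" w] by (simp add: G_def)
    qed blast
    then obtain x where "\<forall>z \<zeta>. (z, \<zeta>) \<in> G'' \<longrightarrow> (\<zeta> + x) \<bullet> (x - z) \<le> 0" by blast
    then have "x \<in> K g" if "g \<in> insert g0 G'" for g
      using that by (force simp: G''_def K_def)
    then have "x \<in> K g0 \<inter> \<Inter> \<F>" using G' by auto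
    then show "K g0 \<inter> \<Inter> \<F> \<noteq> {}" by blast
  qed
  then obtain x where x: "\<And>g. g \<in> G \<Longrightarrow> x \<in> K g" by blast
  have "y - x \<in> \<gamma> x"
  proof (rule maximal_monotoneD[OF assms])
    fix z \<zeta> assume "\<zeta> \<in> \<gamma> z"
    then have "(\<zeta> - y + x) \<bullet> (x - z) \<le> 0"
      using x[of "(z, \<zeta>)"] by (simp add: G_def K_def)
    moreover have "(\<zeta> - (y - x)) \<bullet> (z - x) = - ((\<zeta> - y + x) \<bullet> (x - z))"
      by (simp add: inner_diff_left inner_diff_right inner_add_left)
    ultimately show "0 \<le> (\<zeta> - (y - x)) \<bullet> (z - x)" by linarith
  qed
  then show ?thesis by blast
qed

lemma continuous_resolvent:
  fixes \<gamma> :: "'a::euclidean_space \<Rightarrow> 'a set"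
  assumes "maximal_monotone \<gamma>"
  obtains J where "continuous_on UNIV J" "\<And>y. y - J y \<in> \<gamma> (J y)"
proof -
  obtain J where J: "\<And>y. y - J y \<in> \<gamma> (J y)" using minty[OF assms] by metis
  have "norm (J y - J y') \<le> norm (y - y')" for y y'
  proof -
    have "0 \<le> ((y - J y) - (y' - J y')) \<bullet> (J y - J y')"
      using assms J unfolding maximal_monotone_def monotone_operator_def by blast
    then have "(norm (J y - J y'))\<^sup>2 \<le> (y - y') \<bullet> (J y - J y')"
      unfolding power2_norm_eq_inner by (simp add: inner_diff_left inner_diff_right algebra_simps)
    also have "\<dots> \<le> norm (y - y') * norm (J y - J y')" by (rule norm_cauchy_schwarz)
    finally show ?thesis by (cases "J y = J y'") (auto simp: power2_eq_square)
  qed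
  then have "1-lipschitz_on UNIV J" by (intro lipschitz_onI) (auto simp: dist_norm)
  then show thesis using J lipschitz_on_continuous_on that by blast
qed

section \<open>Singular gradients on a ball\<close>

lemma strictly_convex_on_gradient_inequality:
  assumes "strictly_convex_on S \<Phi>" "x \<in> S" "y \<in> S" "GDERIV \<Phi> x :> p"
  shows "\<Phi> x + p \<bullet> (y - x) \<le> \<Phi> y"
proof (cases "x = y")
  case False
  define f where "f t = \<Phi> (x + t *\<^sub>R (y - x))" for t
  have "((\<lambda>t. x + t *\<^sub>R (y - x)) has_derivative (\<lambda>t. t *\<^sub>R (y - x))) (at 0)"
    by (auto intro!: derivative_eq_intros)
  moreover have "(\<Phi> has_derivative (\<lambda>h. h \<bullet> p)) (at (x + 0 *\<^sub>R (y - x)))"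
    using assms(4) by (simp add: gderiv_def)
  ultimately have "(f has_derivative (\<lambda>t. (t *\<^sub>R (y - x)) \<bullet> p)) (at 0)"
    unfolding f_def by (rule has_derivative_compose)
  then have "(f has_real_derivative p \<bullet> (y - x)) (at 0)"
    by (rule has_derivative_imp_has_field_derivative) (simp add: inner_commute)
  then have "((\<lambda>t. (f t - f 0) / (t - 0)) \<longlongrightarrow> p \<bullet> (y - x)) (at_right 0)"
    unfolding has_field_derivative_iff by (rule tendsto_mono[rotated]) (simp add: at_le)
  moreover have "\<forall>\<^sub>F t in at_right 0. (f t - f 0) / (t - 0) \<le> \<Phi> y - \<Phi> x"
    using eventually_at_right_less[of 0] eventually_at_right_real[of 0 1, OF zero_less_one]
  proof eventually_elim
    case (elim t)
    then have "0 < t" "t < 1" by auto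
    then have "\<Phi> ((1 - t) *\<^sub>R x + t *\<^sub>R y) < (1 - t) * \<Phi> x + t * \<Phi> y"
      using assms(1-3) False unfolding strictly_convex_on_def by blast
    moreover have "(1 - t) *\<^sub>R x + t *\<^sub>R y = x + t *\<^sub>R (y - x)" by (simp add: algebra_simps)
    ultimately have "f t - f 0 \<le> t * (\<Phi> y - \<Phi> x)" by (simp add: f_def algebra_simps)
    then show ?case using \<open>0 < t\<close> by (simp add: divide_le_eq mult.commute)
  qed
  ultimately have "p \<bullet> (y - x) \<le> \<Phi> y - \<Phi> x"
    by (rule tendsto_upperbound) simp
  then show ?thesis by simp
qed simp

text \<open>
The gradient inequality with \<open>y = (a/2) sgn (\<phi> x)\<close> shows that \<open>\<phi> x \<bullet> x\<close> grows at least like \<open>|\<phi> x|\<close>, which tends to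
infinity at the boundary since \<open>\<phi>\<close> is a homeomorphism onto the whole space. Hence \<open>\<phi> x \<bullet> x > K\<close> for
\<open>b \<le> |x| < a\<close>, and \<open>\<phi>'\<close> is \<open>\<phi>\<close> composed with the radial projection onto the ball of radius \<open>b\<close>.
\<close>

lemma singular_gradient_coercive_extension:
  fixes \<phi> :: "'a::euclidean_space \<Rightarrow> 'a"
  assumes "a > 0" "homeomorphism (ball 0 a) UNIV \<phi> \<psi>" "\<phi> 0 = 0"
    and grad: "\<And>x. x \<in> ball 0 a \<Longrightarrow> GDERIV \<Phi> x :> \<phi> x"
    and "continuous_on (cball 0 a) \<Phi>" "strictly_convex_on (cball 0 a) \<Phi>"
  obtains b \<phi>' where "0 < b" "b < a" "continuous_on UNIV \<phi>'" "\<And>x. norm x < b \<Longrightarrow> \<phi>' x = \<phi> x"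
    "\<And>x. 0 \<le> \<phi>' x \<bullet> x" "\<And>x. b \<le> norm x \<Longrightarrow> K < \<phi>' x \<bullet> x"
proof -
  have ineq: "\<Phi> x + \<phi> x \<bullet> (y - x) \<le> \<Phi> y" if "x \<in> ball 0 a" "y \<in> cball 0 a" for x y
    using that by (intro strictly_convex_on_gradient_inequality[OF assms(6)] grad) auto
  have nonneg: "0 \<le> \<phi> x \<bullet> x" if "x \<in> ball 0 a" for x
    using ineq[of x 0] ineq[of 0 x] that \<open>a > 0\<close> \<open>\<phi> 0 = 0\<close> by simp
  have "bounded (\<Phi> ` cball 0 a)"
    using assms(5) by (intro compact_imp_bounded compact_continuous_image) auto
  then obtain B where B: "\<And>x. x \<in> cball 0 a \<Longrightarrow> \<bar>\<Phi> x\<bar> \<le> B"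
    unfolding bounded_iff by (metis image_eqI real_norm_def)
  \<comment> \<open>The constants \<open>W\<close> and \<open>b\<close> below are chosen so that \<open>a/2 |\<phi> x| - 2B > K\<close> once \<open>|x| \<ge> b\<close>.\<close>
  have lower: "a / 2 * norm (\<phi> x) - 2 * B \<le> \<phi> x \<bullet> x" if "x \<in> ball 0 a" for x
  proof -
    define y where "y = (a / 2) *\<^sub>R sgn (\<phi> x)"
    have y: "y \<in> cball 0 a" using \<open>a > 0\<close> by (simp add: y_def norm_sgn)
    have "\<phi> x \<bullet> sgn (\<phi> x) = norm (\<phi> x)"
      by (cases "\<phi> x = 0") (simp_all add: sgn_div_norm power2_norm_eq_inner[symmetric] power2_eq_square)
    then have "\<phi> x \<bullet> y = a / 2 * norm (\<phi> x)" by (simp add: y_def)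
    then show ?thesis
      using ineq[OF that y] B[OF y] B[of x] that by (simp add: inner_diff_right)
  qed
  define W where "W = 2 * (\<bar>K\<bar> + 2 * \<bar>B\<bar>) / a"
  have "W \<ge> 0" using \<open>a > 0\<close> by (simp add: W_def)
  have "compact (\<psi> ` cball 0 W)"
    by (intro compact_continuous_image continuous_on_subset[OF homeomorphism_cont2[OF assms(2)]]) auto
  moreover have "\<psi> ` cball 0 W \<noteq> {}" using \<open>W \<ge> 0\<close> by simp
  ultimately obtain x0 where x0: "x0 \<in> \<psi> ` cball 0 W" "\<And>x. x \<in> \<psi> ` cball 0 W \<Longrightarrow> norm x \<le> norm x0"
    using continuous_attains_sup[of "\<psi> ` cball 0 W" norm] by (auto intro: continuous_on_norm_id)
  have "norm x0 < a"
    using x0(1) homeomorphism_image2[OF assms(2)] by auto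
  define b where "b = (norm x0 + a) / 2"
  have b: "0 < b" "b < a" "norm x0 < b"
    using \<open>norm x0 < a\<close> \<open>a > 0\<close> by (simp_all add: b_def add_nonneg_pos)
  have big: "K < \<phi> x \<bullet> x" if "b \<le> norm x" "norm x < a" for x
  proof -
    have "x \<in> ball 0 a" using that by simp
    have "x \<notin> \<psi> ` cball 0 W" using x0(2)[of x] that b by auto
    moreover have "x = \<psi> (\<phi> x)" using homeomorphism_apply1[OF assms(2) \<open>x \<in> ball 0 a\<close>] by simp
    ultimately have "\<phi> x \<notin> cball 0 W" by blast
    then have "W < norm (\<phi> x)" by simp
    then have "a / 2 * W < a / 2 * norm (\<phi> x)" using \<open>a > 0\<close> by simp
    moreover have "a / 2 * W = \<bar>K\<bar> + 2 * \<bar>B\<bar>" using \<open>a > 0\<close> by (simp add: W_def)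
    ultimately show ?thesis using lower[OF \<open>x \<in> ball 0 a\<close>] by linarith
  qed
  define s where "s x = max 1 (norm x / b)" for x :: 'a
  define \<phi>' where "\<phi>' x = \<phi> (x /\<^sub>R s x)" for x
  have s1: "s x \<ge> 1" for x by (simp add: s_def)
  have sb: "norm x \<le> s x * b" for x using b by (simp add: s_def max_def field_simps)
  have in_cball: "norm (x /\<^sub>R s x) \<le> b" for x
    using sb[of x] s1[of x] by (simp add: field_simps)
  have scale: "\<phi>' x \<bullet> x = s x * (\<phi> (x /\<^sub>R s x) \<bullet> (x /\<^sub>R s x))" for x
    using s1[of x] by (simp add: \<phi>'_def)
  show thesis
  proof (rule that[OF b(1,2)])
    have "continuous_on UNIV s" unfolding s_def using b by (intro continuous_intros) auto
    moreover have "s x \<noteq> 0" for x using s1[of x] by simp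
    ultimately have "continuous_on UNIV (\<lambda>x. x /\<^sub>R s x)" by (intro continuous_intros) auto
    then show "continuous_on UNIV \<phi>'"
      unfolding \<phi>'_def
      by (rule continuous_on_compose2[OF homeomorphism_cont1[OF assms(2)]])
        (use le_less_trans[OF in_cball b(2)] in auto)
    show "\<phi>' x = \<phi> x" if "norm x < b" for x
      using that b by (simp add: \<phi>'_def s_def max_def)
    have nn: "0 \<le> \<phi> (x /\<^sub>R s x) \<bullet> (x /\<^sub>R s x)" for x
      using in_cball[of x] b by (intro nonneg) simp
    then show "0 \<le> \<phi>' x \<bullet> x" for x
      unfolding scale using s1[of x] by (intro mult_nonneg_nonneg) auto
    show "K < \<phi>' x \<bullet> x" if "b \<le> norm x" for x
    proof -
      have "s x = norm x / b" using that b by (simp add: s_def max_def field_simps)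
      then have "norm (x /\<^sub>R s x) = b" using that b by auto
      then have "K < \<phi> (x /\<^sub>R s x) \<bullet> (x /\<^sub>R s x)" using big b(2) by (metis order_refl)
      also have "\<dots> \<le> s x * (\<phi> (x /\<^sub>R s x) \<bullet> (x /\<^sub>R s x))"
        using mult_right_mono[OF s1[of x] nn[of x]] by simp
      finally show ?thesis unfolding scale .
    qed
  qed
qed

section \<open>A priori estimate and existence\<close>

text \<open>
For \<open>|x n| > \<rho>\<close> this is the uniform limsup condition, and for \<open>|x n| \<le> \<rho>\<close> the values of \<open>f n\<close> are bounded.
\<close>

lemma uniform_limsup_neg_energy_bound:
  assumes M: "\<And>\<rho>. \<rho> > 0 \<Longrightarrow> M_bound T f n \<rho> < \<infinity>" and "uniform_limsup_neg T f n"
  shows "\<exists>\<sigma> K. \<sigma> > 0 \<and> K \<ge> 0 \<and> (\<forall>x\<in>grid_funs T. f n x \<bullet> x n \<le> K - \<sigma> * (norm (x n))\<^sup>2)"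
proof -
  obtain \<sigma> \<rho> where \<sigma>: "\<sigma> > 0" "\<rho> > 0"
    "\<And>x. x \<in> grid_funs T \<Longrightarrow> norm (x n) > \<rho> \<Longrightarrow> f n x \<bullet> x n < - \<sigma> * (norm (x n))\<^sup>2"
    using assms(2) unfolding uniform_limsup_neg_def by metis
  define C where "C = \<bar>real_of_ereal (M_bound T f n \<rho>)\<bar>"
  have C: "norm (f n x) \<le> C" if "x \<in> grid_funs T" "norm (x n) \<le> \<rho>" for x
  proof -
    have "ereal (norm (f n x)) \<le> M_bound T f n \<rho>"
      unfolding M_bound_def by (rule Sup_upper) (use that in blast)
    then show ?thesis
      using M[OF \<sigma>(2)] unfolding C_def by (cases "M_bound T f n \<rho>") auto
  qed
  have "C \<ge> 0" unfolding C_def by (rule abs_ge_zero)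
  have "f n x \<bullet> x n \<le> (C * \<rho> + \<sigma> * \<rho>\<^sup>2) - \<sigma> * (norm (x n))\<^sup>2" if x: "x \<in> grid_funs T" for x
  proof (cases "norm (x n) \<le> \<rho>")
    case True
    have "f n x \<bullet> x n \<le> norm (f n x) * norm (x n)" by (rule norm_cauchy_schwarz)
    also have "\<dots> \<le> C * \<rho>" using C[OF x True] True \<open>C \<ge> 0\<close> by (intro mult_mono) auto
    finally have "f n x \<bullet> x n \<le> C * \<rho>" .
    moreover have "\<sigma> * (norm (x n))\<^sup>2 \<le> \<sigma> * \<rho>\<^sup>2"
      using True \<sigma> by (intro mult_left_mono power_mono) auto
    ultimately show ?thesis by linarith
  next
    case False
    have "0 \<le> C * \<rho>" "0 \<le> \<sigma> * \<rho>\<^sup>2" using \<sigma> \<open>C \<ge> 0\<close> by auto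
    then show ?thesis using \<sigma>(3)[OF x] False by force
  qed
  moreover have "0 \<le> C * \<rho> + \<sigma> * \<rho>\<^sup>2" using \<sigma> \<open>C \<ge> 0\<close> by simp
  ultimately show ?thesis using \<sigma>(1) by blast
qed

lemma summation_by_parts_inner:
  fixes u w :: "nat \<Rightarrow> 'a::real_inner"
  shows "(\<Sum>n=1..T. (w (n - 1) - w n) \<bullet> u n)
    = (\<Sum>n\<le>T. w n \<bullet> fdiff u n) + w 0 \<bullet> u 0 - w T \<bullet> u (T + 1)"
  by (induction T) (simp_all add: fdiff_def inner_diff_left inner_diff_right)

theorem theorem3p3:
  fixes a :: real and T :: nat
    and \<phi> :: "real ^ 'n \<Rightarrow> real ^ 'n"
    and \<Phi> :: "real ^ 'n \<Rightarrow> real"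
    and \<gamma> :: "(real ^ 'n) \<times> (real ^ 'n) \<Rightarrow> ((real ^ 'n) \<times> (real ^ 'n)) set"
    and f :: "nat \<Rightarrow> (nat \<Rightarrow> real ^ 'n) \<Rightarrow> real ^ 'n"
  assumes "a > 0" and "T \<ge> 2"
    and "\<exists>\<psi>. homeomorphism (ball 0 a) UNIV \<phi> \<psi>"
    and "\<phi> 0 = 0"
    and "\<forall>x\<in>ball 0 a. GDERIV \<Phi> x :> \<phi> x"
    and "C1_on (ball 0 a) \<Phi>"
    and "continuous_on (cball 0 a) \<Phi>"
    and "strictly_convex_on (cball 0 a) \<Phi>"
    and "\<Phi> 0 = 0"
    and "maximal_monotone \<gamma>"
    and "(0, 0) \<in> \<gamma> (0, 0)"
    and "continuous_on ({1..T} \<times> grid_funs T) (\<lambda>(n, x). f n x)"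
    and "\<forall>n\<in>{1..T}. \<forall>\<rho>>0. M_bound T f n \<rho> < \<infinity>"
    and "\<forall>n\<in>{1..T}. uniform_limsup_neg T f n"
  shows "\<exists>u. is_solution a T \<phi> \<gamma> f u"
proof -
  obtain \<psi> where \<psi>: "homeomorphism (ball 0 a) UNIV \<phi> \<psi>" using assms(3) by blast
  obtain J where J: "continuous_on UNIV J" "\<And>y. y - J y \<in> \<gamma> (J y)"
    using continuous_resolvent[OF assms(10)] by metis
  have "\<forall>n\<in>{1..T}. \<exists>\<sigma> K. \<sigma> > 0 \<and> K \<ge> 0 \<and> (\<forall>x\<in>grid_funs T. f n x \<bullet> x n \<le> K - \<sigma> * (norm (x n))\<^sup>2)"
    using assms(13,14) by (intro ballI uniform_limsup_neg_energy_bound) auto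
  from bchoice[OF this] obtain \<sigma> where "\<forall>n\<in>{1..T}. \<exists>K. \<sigma> n > 0 \<and> K \<ge> 0 \<and>
      (\<forall>x\<in>grid_funs T. f n x \<bullet> x n \<le> K - \<sigma> n * (norm (x n))\<^sup>2)" ..
  from bchoice[OF this] obtain \<kappa> where \<sigma>\<kappa>: "\<forall>n\<in>{1..T}. \<sigma> n > 0 \<and> \<kappa> n \<ge> 0 \<and>
      (\<forall>x\<in>grid_funs T. f n x \<bullet> x n \<le> \<kappa> n - \<sigma> n * (norm (x n))\<^sup>2)" ..
  have \<sigma>: "\<sigma> n > 0" "\<kappa> n \<ge> 0" "\<And>x. x \<in> grid_funs T \<Longrightarrow> f n x \<bullet> x n \<le> \<kappa> n - \<sigma> n * (norm (x n))\<^sup>2"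
    if "n \<in> {1..T}" for n
    using bspec[OF \<sigma>\<kappa> that] by auto
  define K where "K = (\<Sum>n=1..T. \<kappa> n)"
  obtain b \<phi>' where \<phi>': "0 < b" "b < a" "continuous_on UNIV \<phi>'" "\<And>x. norm x < b \<Longrightarrow> \<phi>' x = \<phi> x"
    "\<And>x. 0 \<le> \<phi>' x \<bullet> x" "\<And>x. b \<le> norm x \<Longrightarrow> K < \<phi>' x \<bullet> x"
    using singular_gradient_coercive_extension[OF assms(1) \<psi> assms(4) _ assms(7,8), of K] assms(5)
    by blast
  \<comment> \<open>\<open>Q\<close> will bound the interior values of \<open>u\<close>, and \<open>Q + a\<close> all values, so that \<open>r\<close> exceeds the norm of \<open>u\<close>.\<close>
  define Q where "Q = sqrt (\<Sum>n=1..T. K / \<sigma> n)"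
  define r where "r = sqrt (real (T + 2) * (Q + a)\<^sup>2 + 1)"
  have r2: "r\<^sup>2 = real (T + 2) * (Q + a)\<^sup>2 + 1" unfolding r_def by (rule real_sqrt_pow2) simp
  have "r > 0" unfolding r_def by (intro real_sqrt_gt_zero add_nonneg_pos) auto
  define w where "w u m = \<phi>' (fdiff u m)" for u m
  define z where "z u = (u 0, u (T + 1))" for u :: "nat \<Rightarrow> real ^ 'n"
  define \<beta> where "\<beta> u = (w u 0, - w u T)" for u
  \<comment> \<open>The two end point components of \<open>F\<close> encode the boundary condition, the others the difference equation.\<close>
  define F where "F u n = (if n = 0 then fst (z u - J (z u + \<beta> u))
     else if n = T + 1 then snd (z u - J (z u + \<beta> u)) else w u (n - 1) - w u n - f n u)" for u n
  have wcont: "continuous_on S (\<lambda>u. w u m)" for S m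
    unfolding w_def fdiff_def
    by (intro continuous_on_compose2[OF \<phi>'(3)] continuous_intros
        continuous_on_subset[OF continuous_on_product_coordinates]) auto
  have zcont: "continuous_on S z" for S
    unfolding z_def
    by (intro continuous_intros continuous_on_subset[OF continuous_on_product_coordinates]) auto
  have \<beta>cont: "continuous_on S \<beta>" for S
    unfolding \<beta>_def by (intro continuous_intros wcont)
  have bccont: "continuous_on S (\<lambda>u. z u - J (z u + \<beta> u))" for S
    by (intro continuous_on_compose2[OF J(1)] continuous_intros zcont \<beta>cont) auto
  have fcont: "continuous_on (grid_funs T) (f n)" if "n \<in> {1..T}" for n
    using continuous_on_compose2[OF assms(12), of "grid_funs T" "\<lambda>u. (n, u)"] that
    by (force intro: continuous_intros)
  have Fcont: "continuous_on (grid_funs T) (\<lambda>u. F u n)" if "n \<in> {0..T + 1}" for n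
  proof -
    consider "n = 0" | "n = T + 1" | "n \<in> {1..T}" using \<open>n \<in> {0..T+1}\<close> by fastforce
    then show ?thesis
    proof cases
      case 1
      then show ?thesis unfolding F_def using continuous_on_fst[OF bccont] by simp
    next
      case 2
      then show ?thesis unfolding F_def using continuous_on_snd[OF bccont] by simp
    next
      case 3
      then have "(\<lambda>u. F u n) = (\<lambda>u. w u (n - 1) - w u n - f n u)" by (auto simp: F_def)
      then show ?thesis using 3 by (simp only:) (intro continuous_intros wcont fcont)
    qed
  qed
  obtain u \<mu> where u: "u \<in> grid_funs T" and "\<mu> \<ge> 0"
    and Fu: "\<And>n. n \<in> {0..T + 1} \<Longrightarrow> F u n = - \<mu> *\<^sub>R u n"
    and sphere: "\<mu> > 0 \<Longrightarrow> (\<Sum>n=0..T+1. (norm (u n))\<^sup>2) = r\<^sup>2"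
    using zero_or_inward_ray_vec[of "{0..T + 1}" r F] Fcont \<open>r > 0\<close>
    unfolding grid_funs_def by (metis finite_atLeastAtMost)
  define y where "y = z u + \<beta> u"
  have "fst (z u - J y) = - \<mu> *\<^sub>R u 0" "snd (z u - J y) = - \<mu> *\<^sub>R u (T + 1)"
    using Fu[of 0] Fu[of "T + 1"] by (simp_all add: F_def y_def)
  then have zJ: "z u - J y = - \<mu> *\<^sub>R z u" by (simp add: prod_eq_iff z_def)
  then have Jy: "J y = (1 + \<mu>) *\<^sub>R z u" by (simp add: algebra_simps)
  have "y - J y = \<beta> u + (z u - J y)" by (simp add: y_def)
  also have "\<dots> = \<beta> u - \<mu> *\<^sub>R z u" by (simp only: zJ) simp
  finally have mem: "\<beta> u - \<mu> *\<^sub>R z u \<in> \<gamma> ((1 + \<mu>) *\<^sub>R z u)"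
    using J(2)[of y] Jy by metis
  \<comment> \<open>This is monotonicity of \<open>\<gamma>\<close> between the point just found and the origin.\<close>
  have bdry: "\<mu> * (z u \<bullet> z u) \<le> \<beta> u \<bullet> z u"
  proof -
    have "monotone_operator \<gamma>" using assms(10) by (simp add: maximal_monotone_def)
    then have "0 \<le> ((\<beta> u - \<mu> *\<^sub>R z u) - (0, 0)) \<bullet> ((1 + \<mu>) *\<^sub>R z u - (0, 0))"
      using mem assms(11) unfolding monotone_operator_def by blast
    then have "0 \<le> (1 + \<mu>) * (\<beta> u \<bullet> z u - \<mu> * (z u \<bullet> z u))"
      by (simp add: inner_diff_left flip: zero_prod_def)
    then show ?thesis using \<open>\<mu> \<ge> 0\<close> by (simp add: zero_le_mult_iff)
  qed
  have inner_eq: "w u (n - 1) - w u n = f n u - \<mu> *\<^sub>R u n" if "n \<in> {1..T}" for n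
    using Fu[of n] that by (simp add: F_def algebra_simps)
  have energy: "(\<Sum>n\<le>T. w u n \<bullet> fdiff u n) + (\<Sum>n=1..T. \<sigma> n * (norm (u n))\<^sup>2) \<le> K"
  proof -
    have "(\<Sum>n=1..T. (w u (n - 1) - w u n) \<bullet> u n) \<le> (\<Sum>n=1..T. \<kappa> n - \<sigma> n * (norm (u n))\<^sup>2)"
    proof (rule sum_mono)
      fix n assume n: "n \<in> {1..T}"
      have "(w u (n - 1) - w u n) \<bullet> u n = f n u \<bullet> u n - \<mu> * (u n \<bullet> u n)"
        unfolding inner_eq[OF n] by (simp add: inner_diff_left)
      moreover have "0 \<le> \<mu> * (u n \<bullet> u n)" using \<open>\<mu> \<ge> 0\<close> by simp
      ultimately show "(w u (n - 1) - w u n) \<bullet> u n \<le> \<kappa> n - \<sigma> n * (norm (u n))\<^sup>2"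
        using \<sigma>(3)[OF n u] by linarith
    qed
    moreover have "(\<Sum>n=1..T. (w u (n - 1) - w u n) \<bullet> u n)
        = (\<Sum>n\<le>T. w u n \<bullet> fdiff u n) + \<beta> u \<bullet> z u"
      unfolding summation_by_parts_inner by (simp add: \<beta>_def z_def)
    moreover have "0 \<le> \<beta> u \<bullet> z u"
      using bdry \<open>\<mu> \<ge> 0\<close> by (meson inner_ge_zero mult_nonneg_nonneg order_trans)
    ultimately show ?thesis by (simp add: sum_subtractf K_def)
  qed
  have w_nonneg: "0 \<le> w u n \<bullet> fdiff u n" for n unfolding w_def by (rule \<phi>'(5))
  have \<sigma>_nonneg: "0 \<le> \<sigma> n * (norm (u n))\<^sup>2" if "n \<in> {1..T}" for n
    using \<sigma>(1)[OF that] by simp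
  have small: "norm (fdiff u n) < b" if "n \<le> T" for n
  proof (rule ccontr)
    assume "\<not> norm (fdiff u n) < b"
    then have "K < w u n \<bullet> fdiff u n" unfolding w_def using \<phi>'(6) by simp
    also have "\<dots> \<le> (\<Sum>n\<le>T. w u n \<bullet> fdiff u n)"
      using that w_nonneg by (intro member_le_sum) auto
    also have "\<dots> \<le> K" using energy sum_nonneg[of "{1..T}" "\<lambda>n. \<sigma> n * (norm (u n))\<^sup>2"] \<sigma>_nonneg by force
    finally show False by simp
  qed
  have "K \<ge> 0" unfolding K_def using \<sigma>(2) by (intro sum_nonneg) auto
  have interior: "norm (u n) \<le> Q" if n: "n \<in> {1..T}" for n
  proof -
    have "\<sigma> n * (norm (u n))\<^sup>2 \<le> (\<Sum>n=1..T. \<sigma> n * (norm (u n))\<^sup>2)"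
      using n \<sigma>_nonneg by (intro member_le_sum) auto
    also have "\<dots> \<le> K"
      using energy sum_nonneg[of "{..T}" "\<lambda>n. w u n \<bullet> fdiff u n"] w_nonneg by force
    finally have "(norm (u n))\<^sup>2 \<le> K / \<sigma> n" using \<sigma>(1)[OF n] by (simp add: field_simps)
    also have "\<dots> \<le> (\<Sum>n=1..T. K / \<sigma> n)"
      using n \<open>K \<ge> 0\<close> \<sigma>(1) by (intro member_le_sum) (auto intro: divide_nonneg_pos)
    finally show ?thesis unfolding Q_def by (rule real_le_rsqrt)
  qed
  have all: "norm (u n) \<le> Q + a" if "n \<in> {0..T + 1}" for n
  proof -
    consider "n = 0" | "n = T + 1" | "n \<in> {1..T}" using \<open>n \<in> {0..T + 1}\<close> by fastforce
    then show ?thesis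
    proof cases
      case 1
      have "norm (u 0) \<le> norm (u 1) + norm (fdiff u 0)"
        using norm_triangle_ineq4[of "u 1" "fdiff u 0"] by (simp add: fdiff_def)
      then show ?thesis using interior[of 1] small[of 0] \<open>T \<ge> 2\<close> \<phi>'(2) 1 by simp
    next
      case 2
      have "norm (u (T + 1)) \<le> norm (u T) + norm (fdiff u T)"
        using norm_triangle_ineq[of "u T" "fdiff u T"] by (simp add: fdiff_def)
      then show ?thesis using interior[of T] small[of T] \<open>T \<ge> 2\<close> \<phi>'(2) 2 by simp
    qed (use interior \<open>a > 0\<close> in fastforce)
  qed
  have "\<mu> = 0"
  proof (rule ccontr)
    assume "\<mu> \<noteq> 0"
    then have "r\<^sup>2 = (\<Sum>n=0..T+1. (norm (u n))\<^sup>2)" using sphere \<open>\<mu> \<ge> 0\<close> by simp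
    also have "\<dots> \<le> (\<Sum>n=0..T+1. (Q + a)\<^sup>2)"
      using all by (intro sum_mono power_mono) auto
    finally show False unfolding r2 by simp
  qed
  have w_eq: "\<phi> (fdiff u n) = w u n" if "n \<le> T" for n
    unfolding w_def using \<phi>'(4)[OF small[OF that]] by simp
  have bc: "(\<phi> (fdiff u 0), - \<phi> (fdiff u T)) \<in> \<gamma> (u 0, u (T + 1))"
    using mem \<open>\<mu> = 0\<close> w_eq[of 0] w_eq[of T] by (simp add: \<beta>_def z_def)
  have "is_solution a T \<phi> \<gamma> f u"
    unfolding is_solution_def
  proof (intro conjI ballI)
    show "fdiff_sup_norm T u < a"
    proof -
      have "norm (fdiff u (n - 1)) < a" if "n \<in> {1..T + 1}" for n
        using that by (intro less_trans[OF small \<phi>'(2)]) auto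
      then show ?thesis unfolding fdiff_sup_norm_def by (subst Max_less_iff) auto
    qed
    show "(u 0, u (T + 1)) \<in> operator_domain \<gamma>"
      using bc by (auto simp: operator_domain_def)
    fix n assume n: "n \<in> {1..T}"
    then have "\<phi> (fdiff u n) = w u n" "\<phi> (fdiff u (n - 1)) = w u (n - 1)"
      by (auto intro!: w_eq)
    then show "- fdiff (\<lambda>m. \<phi> (fdiff u m)) (n - 1) = f n u"
      using inner_eq[OF n] \<open>\<mu> = 0\<close> n by (simp add: fdiff_def[of "\<lambda>m. \<phi> (fdiff u m)"])
  qed (fact u bc)+
  then show ?thesis by blast
qed

end
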